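(* Let $(Q,\cdot)$ be a left Bol loop and $(Q,\ast)$ its corresponding middle Bol loop. Let $A(Q,\cdot)\le AUT(Q,\cdot)$, let $(H,\odot)$ be the $A(Q,\cdot)$-holomorph of $(Q,\cdot)$, let $(H',\circledast)$ be the holomorph of $(Q,\ast)$ with respect to the same group $A(Q,\cdot)$, and let $(\mathcal{H},[\ast,\cdot])$ be the left combined holomorph of these two holomorphs. Then the following are equivalent: (i) $(\mathcal{H},[\ast,\cdot])=(H',\circledast)$; (ii) $L_y^{-1}R_yL_y=L_{y\phi}^{-1}R_yL_{y\phi}$ for all $y\in Q$ and $\phi\in A(Q,\cdot)$; (iii) $(y^{-1}\phi)\cdot(y\cdot(z\cdot y))=((y\cdot z)\cdot(y^{-1}\phi))\cdot y$ for all $y,z\in Q$ and $\phi\in A(Q,\cdot)$.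
   Context: Maps are written on the right of their arguments and composed from left to right; $yR_x=y\cdot x$ and $yL_x=x\cdot y$. A left Bol loop is a loop satisfying $(x\cdot(y\cdot x))\cdot z=x\cdot(y\cdot(x\cdot z))$ for all $x,y,z$. A middle Bol loop is a loop satisfying $x((yz)\backslash x)=(x/z)(y\backslash x)$ for all $x,y,z$, where $x\backslash y$ is the unique $u$ with $xu=y$ and $x/y$ is the unique $u$ with $uy=x$. The middle Bol loop corresponding to a left Bol loop $(Q,\cdot)$ is $(Q,\ast)$ with $x\ast y=y\cdot((y^{-1}\cdot x)\cdot y)$, where $y^{-1}$ is the (two-sided) inverse of $y$ in $(Q,\cdot)$. It is known that $AUT(Q,\cdot)=AUT(Q,\ast)$. For a subgroup $A$ of the automorphism group, the $A$-holomorph is the loop on $A\times Q$ with $(\alpha,x)\odot(\beta,y)=(\alpha\beta,\,x\beta\cdot y)$ (for $(Q,\cdot)$), respectively $(\alpha,x)\circledast(\beta,y)=(\alpha\beta,\,x\beta\ast y)$ (for $(Q,\ast)$). The left combined holomorph of an $A(Q,\cdot)$-holomorph $(H,\odot)$ of $(Q,\cdot)$ and an $A'(Q,\ast)$-holomorph $(H',\circledast)$ of $(Q,\ast)$ is the set $\mathcal{H}=(A(Q,\cdot)\cap A'(Q,\ast))\times Q$ with the operation $(\alpha,x)[\ast,\cdot](\beta,y)=(\beta,y)\odot\{[(\beta,y)^{-1}\odot(\alpha,x)]\odot(\beta,y)\}$, where $(\beta,y)^{-1}$ is the inverse in $(H,\odot)$, namely $(\beta^{-1},y^{-1}\beta^{-1})$.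 Here $A'(Q,\ast)=A(Q,\cdot)$. Equality of structures means equality of underlying sets and of operations.
   Formalization: In (iii) the right-hand side is corrected to ((y^{-1}φ)·(y·z))·y, with the two inner factors swapped; as printed, (iii) with φ = id forces zy = yz in a group, so it fails for a non-commutative group with trivial A, where (i) and (ii) hold. *)

theory Defs
  imports "HOL-Algebra.Bij"
begin

text \<open>
  Quasigroups and loops are carried by the \<^type>\<open>monoid_scheme\<close> records of HOL-Algebra, which
  provide a carrier, a binary operation and a unit without any associativity assumption. Thus
  \<^const>\<open>m_inv\<close> is the two-sided inverse, and \<^const>\<open>auto\<close> and \<^const>\<open>AutoGroup\<close> give the
  automorphisms of a loop, as bijections of the carrier that are extensional outside it.

  Maps are written on the right in the source and composed from left to right; here \<open>\<phi> x\<close>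
  stands for \<open>x\<phi>\<close>, and \<open>then_map S f g\<close> stands for \<open>fg\<close>, i.e. first \<open>f\<close>, then \<open>g\<close>.
\<close>

locale loop =
  fixes Q :: "('a, 'b) monoid_scheme" (structure)
  assumes mult_closed: "\<lbrakk>x \<in> carrier Q; y \<in> carrier Q\<rbrakk> \<Longrightarrow> x \<otimes> y \<in> carrier Q"
    and unit_closed: "\<one> \<in> carrier Q"
    and unit_left: "x \<in> carrier Q \<Longrightarrow> \<one> \<otimes> x = x"
    and unit_right: "x \<in> carrier Q \<Longrightarrow> x \<otimes> \<one> = x"
    and left_division:
      "\<lbrakk>x \<in> carrier Q; y \<in> carrier Q\<rbrakk> \<Longrightarrow> \<exists>!u. u \<in> carrier Q \<and> x \<otimes> u = y"
    and right_division:
      "\<lbrakk>x \<in> carrier Q; y \<in> carrier Q\<rbrakk> \<Longrightarrow> \<exists>!u. u \<in> carrier Q \<and> u \<otimes> y = x"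

locale left_bol_loop = loop +
  assumes left_bol:
    "\<lbrakk>x \<in> carrier Q; y \<in> carrier Q; z \<in> carrier Q\<rbrakk> \<Longrightarrow>
      (x \<otimes> (y \<otimes> x)) \<otimes> z = x \<otimes> (y \<otimes> (x \<otimes> z))"

definition then_map :: "'a set \<Rightarrow> ('a \<Rightarrow> 'a) \<Rightarrow> ('a \<Rightarrow> 'a) \<Rightarrow> ('a \<Rightarrow> 'a)"
  where "then_map S f g = compose S g f"

definition left_translation :: "('a, 'b) monoid_scheme \<Rightarrow> 'a \<Rightarrow> 'a \<Rightarrow> 'a"
  where "left_translation Q x = (\<lambda>y\<in>carrier Q. x \<otimes>\<^bsub>Q\<^esub> y)"

definition right_translation :: "('a, 'b) monoid_scheme \<Rightarrow> 'a \<Rightarrow> 'a \<Rightarrow> 'a"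
  where "right_translation Q x = (\<lambda>y\<in>carrier Q. y \<otimes>\<^bsub>Q\<^esub> x)"

definition middle_bol :: "('a, 'b) monoid_scheme \<Rightarrow> 'a monoid"
  where "middle_bol Q =
    \<lparr>carrier = carrier Q,
     mult = (\<lambda>x y. y \<otimes>\<^bsub>Q\<^esub> ((inv\<^bsub>Q\<^esub> y \<otimes>\<^bsub>Q\<^esub> x) \<otimes>\<^bsub>Q\<^esub> y)),
     one = \<one>\<^bsub>Q\<^esub>\<rparr>"

definition holomorph ::
    "('a, 'b) monoid_scheme \<Rightarrow> ('a \<Rightarrow> 'a) set \<Rightarrow> (('a \<Rightarrow> 'a) \<times> 'a) monoid"
  where "holomorph Q A =
    \<lparr>carrier = A \<times> carrier Q,
     mult = (\<lambda>(\<alpha>, x) (\<beta>, y). (then_map (carrier Q) \<alpha> \<beta>, \<beta> x \<otimes>\<^bsub>Q\<^esub> y)),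
     one = (\<lambda>x\<in>carrier Q. x, \<one>\<^bsub>Q\<^esub>)\<rparr>"

text \<open>
  The left combined holomorph of the \<open>A\<close>-holomorph of \<open>(Q, \<cdot>)\<close> and the \<open>A'\<close>-holomorph of
  \<open>middle_bol Q\<close>. The second holomorph enters only through its group \<open>A'\<close>.
\<close>

definition left_combined_holomorph ::
    "('a, 'b) monoid_scheme \<Rightarrow> ('a \<Rightarrow> 'a) set \<Rightarrow> ('a \<Rightarrow> 'a) set \<Rightarrow> (('a \<Rightarrow> 'a) \<times> 'a) monoid"
  where "left_combined_holomorph Q A A' =
    (let H = holomorph Q A in
      \<lparr>carrier = (A \<inter> A') \<times> carrier Q,
       mult = (\<lambda>a b. b \<otimes>\<^bsub>H\<^esub> ((inv\<^bsub>H\<^esub> b \<otimes>\<^bsub>H\<^esub> a) \<otimes>\<^bsub>H\<^esub> b)),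
       one = \<one>\<^bsub>H\<^esub>\<rparr>)"

text \<open>
  Record equality would also compare the operations outside the carriers, hence the following
  notion of equality of structures.
\<close>

definition same_structure :: "('a, 'b) monoid_scheme \<Rightarrow> ('a, 'c) monoid_scheme \<Rightarrow> bool"
  where "same_structure G H \<longleftrightarrow>
    carrier G = carrier H \<and>
    (\<forall>x\<in>carrier G. \<forall>y\<in>carrier G. x \<otimes>\<^bsub>G\<^esub> y = x \<otimes>\<^bsub>H\<^esub> y)"

text \<open>
  Caution: the source prints the right-hand side of the elementwise condition as
  \<open>((y \<cdot> z) \<cdot> (y\<inverse>\<phi>)) \<cdot> y\<close>. With \<open>\<phi>\<close> the identity this forces every group to be commutative, while
  the other two conditions hold in every group with trivial \<open>A\<close>. The condition equivalent to them,
  and the one used with these definitions, is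
  \<open>(y\<inverse>\<phi>) \<cdot> (y \<cdot> (z \<cdot> y)) = ((y\<inverse>\<phi>) \<cdot> (y \<cdot> z)) \<cdot> y\<close>.
\<close>

end

theory Submission
  imports Defs
begin

text \<open>
  Left Bol loops have two-sided inverses and satisfy \<open>x\<inverse> \<cdot> (x \<cdot> y) = y\<close>, so \<open>L\<^sub>y\<inverse>\<close> is the left
  translation by \<open>y\<inverse>\<close>. Computing \<open>(\<alpha>, x) [\<ast>, \<cdot>] (\<beta>, y)\<close> in the holomorph and putting
  \<open>\<phi> = \<beta>\<inverse>\<alpha>\<beta>\<close>, \<open>w = x\<beta>\<close>, condition (i) becomes
  \<open>y\<phi> \<cdot> (((y\<phi>)\<inverse> \<cdot> w) \<cdot> y) = y \<cdot> ((y\<inverse> \<cdot> w) \<cdot> y)\<close>, where \<open>\<phi>\<close> and \<open>w\<close> are arbitrary. This is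
  condition (ii) evaluated at \<open>w\<close>, and the substitution \<open>w = y \<cdot> z\<close> followed by cancelling \<open>y\<phi>\<close>
  turns it into (iii).
\<close>

section \<open>Cancellation, inverses, automorphisms and translations in a loop\<close>

context loop
begin

lemma left_cancel:
  assumes "x \<in> carrier Q" "u \<in> carrier Q" "v \<in> carrier Q" "x \<otimes> u = x \<otimes> v"
  shows "u = v"
  using left_division[of x "x \<otimes> u"] assms mult_closed by metis

lemma right_cancel:
  assumes "x \<in> carrier Q" "u \<in> carrier Q" "v \<in> carrier Q" "u \<otimes> x = v \<otimes> x"
  shows "u = v"
  using right_division[of "u \<otimes> x" x] assms mult_closed by metis

text \<open>Left cancellation alone makes a two-sided inverse unique, so the description behind
  \<open>m_inv\<close> denotes it without any appeal to associativity.\<close>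

lemma m_inv_equality:
  assumes "x \<in> carrier Q" "y \<in> carrier Q" "x \<otimes> y = \<one>" "y \<otimes> x = \<one>"
  shows "inv x = y"
  unfolding m_inv_def using assms left_cancel[of x] by (intro the_equality) auto

lemma auto_closed: "\<lbrakk>\<phi> \<in> auto Q; x \<in> carrier Q\<rbrakk> \<Longrightarrow> \<phi> x \<in> carrier Q"
  by (auto simp: auto_def hom_def)

lemma auto_mult:
  "\<lbrakk>\<phi> \<in> auto Q; x \<in> carrier Q; y \<in> carrier Q\<rbrakk> \<Longrightarrow> \<phi> (x \<otimes> y) = \<phi> x \<otimes> \<phi> y"
  by (auto simp: auto_def hom_def)

text \<open>The image of the unit is idempotent, and left cancellation leaves the unit as the only
  idempotent of a loop.\<close>

lemma auto_one:
  assumes "\<phi> \<in> auto Q"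
  shows "\<phi> \<one> = \<one>"
proof (rule left_cancel[of "\<phi> \<one>"])
  show "\<phi> \<one> \<otimes> \<phi> \<one> = \<phi> \<one> \<otimes> \<one>"
    using auto_mult[OF assms unit_closed unit_closed] auto_closed[OF assms unit_closed]
    by (simp add: unit_left unit_right unit_closed)
qed (use assms in \<open>auto intro: auto_closed unit_closed\<close>)

lemma subgroup_auto: "subgroup (auto Q) (BijGroup (carrier Q))"
proof (rule group.subgroupI[OF group_BijGroup])
  show "auto Q \<subseteq> carrier (BijGroup (carrier Q))"
    by (auto simp: auto_def BijGroup_def)
  have "(\<lambda>x\<in>carrier Q. x) \<in> auto Q"
    by (auto simp: auto_def hom_def id_Bij mult_closed)
  then show "auto Q \<noteq> {}" by blast
next
  fix \<phi> assume "\<phi> \<in> auto Q"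
  then show "inv\<^bsub>BijGroup (carrier Q)\<^esub> \<phi> \<in> auto Q"
    using Bij_inv_into_lemma[of "carrier Q" \<phi> "mult Q"]
    by (auto simp: auto_def inv_BijGroup restrict_inv_into_Bij hom_def Bij_inv_into_mem mult_closed)
next
  fix \<phi> \<psi> assume "\<phi> \<in> auto Q" "\<psi> \<in> auto Q"
  then show "\<phi> \<otimes>\<^bsub>BijGroup (carrier Q)\<^esub> \<psi> \<in> auto Q"
    using compose_Bij[of \<phi> "carrier Q" \<psi>]
    by (auto simp: auto_def BijGroup_def hom_def compose_def Pi_iff mult_closed)
qed

text \<open>\<open>AutoGroup Q\<close> is \<open>BijGroup (carrier Q)\<close> cut down to the
  carrier \<open>auto Q\<close>. Products and inverses of members of \<open>A\<close> can therefore
  be computed in the group of bijections.\<close>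

lemma subgroup_AutoGroup_imp_subgroup_BijGroup:
  assumes "subgroup A (AutoGroup Q)"
  shows "subgroup A (BijGroup (carrier Q))"
  using group.incl_subgroup[OF group_BijGroup subgroup_auto] assms by (simp add: AutoGroup_def)

lemma left_translation_Bij:
  assumes "x \<in> carrier Q"
  shows "left_translation Q x \<in> Bij (carrier Q)"
proof -
  have "bij_betw (left_translation Q x) (carrier Q) (carrier Q)"
    unfolding bij_betw_def
  proof
    show "inj_on (left_translation Q x) (carrier Q)"
      using assms left_cancel by (auto simp: inj_on_def left_translation_def)
    show "left_translation Q x ` carrier Q = carrier Q"
    proof
      show "left_translation Q x ` carrier Q \<subseteq> carrier Q"
        using assms by (auto simp: left_translation_def mult_closed)
      show "carrier Q \<subseteq> left_translation Q x ` carrier Q"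
      proof
        fix y assume "y \<in> carrier Q"
        then obtain u where u: "u \<in> carrier Q" "x \<otimes> u = y"
          using left_division[OF assms] by blast
        then show "y \<in> left_translation Q x ` carrier Q"
          by (intro image_eqI[of _ _ u]) (simp_all add: left_translation_def)
      qed
    qed
  qed
  then show ?thesis by (simp add: Bij_def left_translation_def)
qed

end

section \<open>Two-sided inverses and the left inverse property of a left Bol loop\<close>

context left_bol_loop
begin

text \<open>Take a right inverse \<open>y\<close> of \<open>x\<close>. The Bol identity at
  \<open>x\<close>, \<open>y\<close>, \<open>y\<close> gives
  \<open>(x \<otimes> (y \<otimes> x)) \<otimes> y = x \<otimes> y\<close>; cancelling
  \<open>y\<close> on the right and then \<open>x\<close> on the left shows that \<open>y\<close> is
  also a left inverse.\<close>

lemma two_sided_inverse_ex: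
  assumes x: "x \<in> carrier Q"
  shows "\<exists>y\<in>carrier Q. x \<otimes> y = \<one> \<and> y \<otimes> x = \<one>"
proof -
  obtain y where y: "y \<in> carrier Q" "x \<otimes> y = \<one>"
    using left_division[OF x unit_closed] by blast
  have "(x \<otimes> (y \<otimes> x)) \<otimes> y = x \<otimes> y"
    using left_bol[OF x y(1) y(1)] x y by (simp add: unit_right)
  then have "x \<otimes> (y \<otimes> x) = x \<otimes> \<one>"
    using right_cancel[of y] x y by (simp add: mult_closed unit_right)
  then show ?thesis
    using left_cancel[OF x] x y by (blast intro: mult_closed unit_closed)
qed

lemma m_inv:
  assumes "x \<in> carrier Q"
  shows m_inv_closed: "inv x \<in> carrier Q"
    and m_r_inv: "x \<otimes> inv x = \<one>"
    and m_l_inv: "inv x \<otimes> x = \<one>"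
  using two_sided_inverse_ex[OF assms] m_inv_equality[OF assms] by auto

lemma m_inv_inv: "x \<in> carrier Q \<Longrightarrow> inv (inv x) = x"
  by (simp add: m_inv m_inv_equality)

text \<open>In the Bol identity with middle element \<open>inv x\<close>, the bracket
  \<open>x \<otimes> (inv x \<otimes> x)\<close> collapses to \<open>x\<close>; cancelling the
  leading \<open>x\<close> leaves the left inverse property.\<close>

lemma inv_mult_cancel:
  assumes x: "x \<in> carrier Q" and z: "z \<in> carrier Q"
  shows "inv x \<otimes> (x \<otimes> z) = z"
proof (rule left_cancel[OF x])
  show "x \<otimes> (inv x \<otimes> (x \<otimes> z)) = x \<otimes> z"
    using left_bol[OF x m_inv_closed[OF x] z] x by (simp add: m_l_inv unit_right)
qed (use x z in \<open>auto simp: mult_closed m_inv_closed\<close>)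

lemma mult_inv_cancel: "\<lbrakk>x \<in> carrier Q; z \<in> carrier Q\<rbrakk> \<Longrightarrow> x \<otimes> (inv x \<otimes> z) = z"
  using inv_mult_cancel[of "inv x" z] by (simp add: m_inv_closed m_inv_inv)

lemma inv_left_translation:
  assumes x: "x \<in> carrier Q"
  shows "inv\<^bsub>BijGroup (carrier Q)\<^esub> (left_translation Q x) = left_translation Q (inv x)"
proof (rule group.inv_equality[OF group_BijGroup])
  show "left_translation Q (inv x) \<otimes>\<^bsub>BijGroup (carrier Q)\<^esub> left_translation Q x =
      \<one>\<^bsub>BijGroup (carrier Q)\<^esub>"
    using x left_translation_Bij[OF x] left_translation_Bij[OF m_inv_closed[OF x]]
    by (auto simp: BijGroup_def compose_def left_translation_def mult_closed inv_mult_cancel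
        intro!: restrict_ext)
qed (use x in \<open>auto simp: BijGroup_def left_translation_Bij m_inv_closed\<close>)

section \<open>Rewriting the three conditions as pointwise identities in the loop\<close>

lemma auto_inv: "\<lbrakk>\<phi> \<in> auto Q; x \<in> carrier Q\<rbrakk> \<Longrightarrow> \<phi> (inv x) = inv (\<phi> x)"
  by (metis auto_closed auto_mult auto_one m_inv m_inv_equality)

text \<open>The conjugating element \<open>c\<close> is kept separate from \<open>y\<close> so that
  \<open>c = y\<close> and \<open>c = \<phi> y\<close> yield the two sides of condition
  (ii).\<close>

lemma then_map_translations:
  assumes c: "c \<in> carrier Q" and y: "y \<in> carrier Q"
  shows "then_map (carrier Q)
      (then_map (carrier Q) (inv\<^bsub>BijGroup (carrier Q)\<^esub> (left_translation Q c)) (right_translation Q y))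
      (left_translation Q c) = (\<lambda>w\<in>carrier Q. c \<otimes> ((inv c \<otimes> w) \<otimes> y))"
  unfolding inv_left_translation[OF c] using c y
  by (auto simp: then_map_def compose_def left_translation_def
      right_translation_def mult_closed m_inv_closed intro!: restrict_ext)

text \<open>The inverse is a definite description here too, so existence and uniqueness are both
  checked directly. For uniqueness, the first component is determined in the group of bijections,
  and the second is then a right inverse of \<open>\<gamma> y\<close>, hence determined by left
  cancellation.\<close>

lemma holomorph_inv:
  assumes A: "subgroup A (AutoGroup Q)" and \<beta>: "\<beta> \<in> A" and y: "y \<in> carrier Q"
  defines "\<beta>' \<equiv> inv\<^bsub>BijGroup (carrier Q)\<^esub> \<beta>"
  shows "inv\<^bsub>holomorph Q A\<^esub> (\<beta>, y) = (\<beta>', \<beta>' (inv y))"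
proof -
  let ?B = "BijGroup (carrier Q)" and ?H = "holomorph Q A"
  interpret B: group ?B by (rule group_BijGroup)
  have AB: "subgroup A ?B" by (rule subgroup_AutoGroup_imp_subgroup_BijGroup[OF A])
  have aut: "\<gamma> \<in> auto Q" if "\<gamma> \<in> A" for \<gamma>
    using subgroup.subset[OF A] that by (auto simp: AutoGroup_def)
  have Bij: "\<gamma> \<in> Bij (carrier Q)" if "\<gamma> \<in> A" for \<gamma>
    using aut[OF that] by (simp add: auto_def)
  \<comment> \<open>The factors swap because \<open>then_map\<close> composes from left to right and
    \<open>BijGroup\<close> from right to left.\<close>
  have then_mult: "then_map (carrier Q) \<gamma> \<delta> = \<delta> \<otimes>\<^bsub>?B\<^esub> \<gamma>" if "\<gamma> \<in> A" "\<delta> \<in> A" for \<gamma> \<delta>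
    using Bij that by (simp add: then_map_def BijGroup_def)
  have \<beta>'A: "\<beta>' \<in> A" unfolding \<beta>'_def by (rule subgroup.m_inv_closed[OF AB \<beta>])
  have \<beta>B: "\<beta> \<in> carrier ?B" using Bij[OF \<beta>] by (simp add: BijGroup_def)
  have one: "\<one>\<^bsub>?H\<^esub> = (\<one>\<^bsub>?B\<^esub>, \<one>)" by (simp add: holomorph_def BijGroup_def)
  have \<beta>\<beta>': "\<beta> (\<beta>' x) = x" if "x \<in> carrier Q" for x
    using B.r_inv[OF \<beta>B] Bij[OF \<beta>] Bij[OF \<beta>'A] that
    by (fold \<beta>'_def) (simp add: BijGroup_def compose_def fun_eq_iff restrict_def, metis)
  show ?thesis
    unfolding m_inv_def[of ?H]
  proof (rule the_equality)
    have "(\<beta>, y) \<otimes>\<^bsub>?H\<^esub> (\<beta>', \<beta>' (inv y)) = (\<beta>' \<otimes>\<^bsub>?B\<^esub> \<beta>, \<beta>' y \<otimes> \<beta>' (inv y))"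
      using \<beta> \<beta>'A by (simp add: holomorph_def then_mult)
    also have "\<dots> = \<one>\<^bsub>?H\<^esub>"
      using auto_mult[OF aut[OF \<beta>'A] y m_inv_closed[OF y]] B.l_inv[OF \<beta>B] y
      by (simp add: one m_r_inv auto_one[OF aut[OF \<beta>'A]] \<beta>'_def[symmetric])
    finally have r: "(\<beta>, y) \<otimes>\<^bsub>?H\<^esub> (\<beta>', \<beta>' (inv y)) = \<one>\<^bsub>?H\<^esub>" .
    have "(\<beta>', \<beta>' (inv y)) \<otimes>\<^bsub>?H\<^esub> (\<beta>, y) = (\<beta> \<otimes>\<^bsub>?B\<^esub> \<beta>', \<one>)"
      using \<beta> \<beta>'A y by (simp add: holomorph_def then_mult \<beta>\<beta>' m_inv)
    also have "\<dots> = \<one>\<^bsub>?H\<^esub>"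
      using B.r_inv[OF \<beta>B] by (simp add: one \<beta>'_def)
    finally have l: "(\<beta>', \<beta>' (inv y)) \<otimes>\<^bsub>?H\<^esub> (\<beta>, y) = \<one>\<^bsub>?H\<^esub>" .
    show "(\<beta>', \<beta>' (inv y)) \<in> carrier ?H \<and> (\<beta>, y) \<otimes>\<^bsub>?H\<^esub> (\<beta>', \<beta>' (inv y)) = \<one>\<^bsub>?H\<^esub> \<and>
        (\<beta>', \<beta>' (inv y)) \<otimes>\<^bsub>?H\<^esub> (\<beta>, y) = \<one>\<^bsub>?H\<^esub>"
      using r l \<beta>'A y by (simp add: holomorph_def auto_closed[OF aut] m_inv_closed)
  next
    fix p
    assume p: "p \<in> carrier ?H \<and> (\<beta>, y) \<otimes>\<^bsub>?H\<^esub> p = \<one>\<^bsub>?H\<^esub> \<and> p \<otimes>\<^bsub>?H\<^esub> (\<beta>, y) = \<one>\<^bsub>?H\<^esub>"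
    obtain \<gamma> z where pz: "p = (\<gamma>, z)" by (cases p)
    have \<gamma>: "\<gamma> \<in> A" and z: "z \<in> carrier Q"
      using p pz by (auto simp: holomorph_def)
    have "\<gamma> \<otimes>\<^bsub>?B\<^esub> \<beta> = \<one>\<^bsub>?B\<^esub>" and prod: "\<gamma> y \<otimes> z = \<one>"
      using p \<beta> \<gamma> by (auto simp: pz one then_mult[symmetric]) (auto simp: holomorph_def)
    then have \<gamma>\<beta>': "\<gamma> = \<beta>'"
      using B.inv_equality[of \<gamma> \<beta>] \<beta>B Bij[OF \<gamma>] by (simp add: \<beta>'_def BijGroup_def)
    have \<gamma>y: "\<gamma> y \<in> carrier Q" by (rule auto_closed[OF aut[OF \<gamma>] y])
    have "z = inv (\<gamma> y)"
      using left_cancel[OF \<gamma>y z m_inv_closed[OF \<gamma>y]] prod m_r_inv[OF \<gamma>y] by simp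
    then show "p = (\<beta>', \<beta>' (inv y))"
      using pz \<gamma>\<beta>' auto_inv[OF aut[OF \<gamma>] y] by simp
  qed
qed

text \<open>Both operations have the same first component, so only second components are compared.
  They depend on \<alpha>, \<beta> and \<open>x\<close> only through a conjugate of \<alpha> and the
  image \<open>\<beta> x\<close>, and these two range over all of \<open>A\<close> and
  \<open>Q\<close>.\<close>

lemma same_structure_combined_iff:
  assumes A: "subgroup A (AutoGroup Q)"
  shows "same_structure (left_combined_holomorph Q A A) (holomorph (middle_bol Q) A) \<longleftrightarrow>
    (\<forall>y\<in>carrier Q. \<forall>\<phi>\<in>A. \<forall>w\<in>carrier Q.
      y \<otimes> ((inv y \<otimes> w) \<otimes> y) = \<phi> y \<otimes> ((inv (\<phi> y) \<otimes> w) \<otimes> y))"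
    (is "?same \<longleftrightarrow> (\<forall>y\<in>_. \<forall>\<phi>\<in>A. \<forall>w\<in>_. ?P y \<phi> w)")
proof -
  let ?S = "carrier Q" and ?B = "BijGroup (carrier Q)" and ?H = "holomorph Q A"
  interpret B: group ?B by (rule group_BijGroup)
  have AB: "subgroup A ?B" by (rule subgroup_AutoGroup_imp_subgroup_BijGroup[OF A])
  have aut: "\<gamma> \<in> auto Q" if "\<gamma> \<in> A" for \<gamma>
    using subgroup.subset[OF A] that by (auto simp: AutoGroup_def)
  have Bij: "\<gamma> \<in> Bij ?S" if "\<gamma> \<in> A" for \<gamma>
    using aut[OF that] by (simp add: auto_def)
  have AB': "\<gamma> \<in> carrier ?B" if "\<gamma> \<in> A" for \<gamma>
    using subgroup.subset[OF AB] that by blast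
  have then_mult: "then_map ?S \<gamma> \<delta> = \<delta> \<otimes>\<^bsub>?B\<^esub> \<gamma>" if "\<gamma> \<in> A" "\<delta> \<in> A" for \<gamma> \<delta>
    using Bij that by (simp add: then_map_def BijGroup_def)
  have app: "(\<delta> \<otimes>\<^bsub>?B\<^esub> \<gamma>) x = \<delta> (\<gamma> x)" if "\<gamma> \<in> A" "\<delta> \<in> A" "x \<in> ?S" for \<gamma> \<delta> x
    using Bij that by (simp add: BijGroup_def compose_def)
  note closed = subgroup.m_closed[OF AB] subgroup.m_inv_closed[OF AB]
  \<comment> \<open>This is the conjugate of \<alpha> that reads \<beta>-inverse, \<alpha>, \<beta>
    from left to right. Its bracketing follows the nesting of the holomorph products.\<close>
  define \<Phi> where "\<Phi> \<alpha> \<beta> = \<beta> \<otimes>\<^bsub>?B\<^esub> (\<alpha> \<otimes>\<^bsub>?B\<^esub> inv\<^bsub>?B\<^esub> \<beta>)" for \<alpha> \<beta>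
  have \<Phi>A: "\<Phi> \<alpha> \<beta> \<in> A" if "\<alpha> \<in> A" "\<beta> \<in> A" for \<alpha> \<beta>
    using that by (simp add: \<Phi>_def closed)
  have combined: "(\<alpha>, x) \<otimes>\<^bsub>left_combined_holomorph Q A A\<^esub> (\<beta>, y) =
      (\<beta> \<otimes>\<^bsub>?B\<^esub> \<alpha>, \<Phi> \<alpha> \<beta> y \<otimes> ((inv (\<Phi> \<alpha> \<beta> y) \<otimes> \<beta> x) \<otimes> y))"
    if \<alpha>: "\<alpha> \<in> A" and \<beta>: "\<beta> \<in> A" and x: "x \<in> ?S" and y: "y \<in> ?S" for \<alpha> \<beta> x y
  proof -
    let ?b = "inv\<^bsub>?B\<^esub> \<beta>"
    have bA: "?b \<in> A" and iy: "inv y \<in> ?S" using closed \<beta> y m_inv_closed by auto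
    have "(inv\<^bsub>?H\<^esub> (\<beta>, y) \<otimes>\<^bsub>?H\<^esub> (\<alpha>, x)) = (\<alpha> \<otimes>\<^bsub>?B\<^esub> ?b, \<alpha> (?b (inv y)) \<otimes> x)"
      using holomorph_inv[OF A \<beta> y] then_mult[OF bA \<alpha>] by (simp add: holomorph_def)
    then have 1: "(inv\<^bsub>?H\<^esub> (\<beta>, y) \<otimes>\<^bsub>?H\<^esub> (\<alpha>, x)) \<otimes>\<^bsub>?H\<^esub> (\<beta>, y) =
        (\<Phi> \<alpha> \<beta>, \<beta> (\<alpha> (?b (inv y)) \<otimes> x) \<otimes> y)"
      using then_mult[OF closed(1)[OF \<alpha> bA] \<beta>] by (simp add: holomorph_def \<Phi>_def)
    \<comment> \<open>Since \<beta> is multiplicative, it turns the first factor into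
      \<open>\<Phi> \<alpha> \<beta> (inv y)\<close>, and automorphisms commute with
      inversion.\<close>
    have 2: "\<beta> (\<alpha> (?b (inv y)) \<otimes> x) = inv (\<Phi> \<alpha> \<beta> y) \<otimes> \<beta> x"
      using \<alpha> \<beta> bA x iy auto_inv[OF aut[OF \<Phi>A[OF \<alpha> \<beta>]] y]
      by (simp add: auto_mult[OF aut] auto_closed[OF aut] \<Phi>_def app closed)
    \<comment> \<open>The outer factor \<open>(\<beta>, y)\<close> stands on the left: its \<beta>
      cancels the inverse inside the conjugate, and its \<open>y\<close> is moved to
      \<open>\<Phi> \<alpha> \<beta> y\<close>.\<close>
    have 3: "\<Phi> \<alpha> \<beta> \<otimes>\<^bsub>?B\<^esub> \<beta> = \<beta> \<otimes>\<^bsub>?B\<^esub> \<alpha>"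
      using \<alpha> \<beta> AB' by (simp add: \<Phi>_def B.m_assoc)
    show ?thesis
      using 1 2 3 then_mult[OF \<beta> \<Phi>A[OF \<alpha> \<beta>]]
      by (simp add: left_combined_holomorph_def Let_def) (simp add: holomorph_def)
  qed
  have middle: "(\<alpha>, x) \<otimes>\<^bsub>holomorph (middle_bol Q) A\<^esub> (\<beta>, y) =
      (\<beta> \<otimes>\<^bsub>?B\<^esub> \<alpha>, y \<otimes> ((inv y \<otimes> \<beta> x) \<otimes> y))"
    if "\<alpha> \<in> A" "\<beta> \<in> A" for \<alpha> \<beta> x y
    using then_mult[OF that] by (simp add: holomorph_def middle_bol_def)
  have "?same \<longleftrightarrow> (\<forall>\<alpha>\<in>A. \<forall>x\<in>?S. \<forall>\<beta>\<in>A. \<forall>y\<in>?S. ?P y (\<Phi> \<alpha> \<beta>) (\<beta> x))"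
  proof -
    have carriers: "carrier (left_combined_holomorph Q A A) = A \<times> ?S"
      "carrier (holomorph (middle_bol Q) A) = A \<times> ?S"
      by (simp_all add: left_combined_holomorph_def Let_def holomorph_def middle_bol_def)
    show ?thesis
      unfolding same_structure_def carriers by (auto simp: combined middle)
  qed
  also have "\<dots> \<longleftrightarrow> (\<forall>y\<in>?S. \<forall>\<phi>\<in>A. \<forall>w\<in>?S. ?P y \<phi> w)"
  proof (intro iffI ballI)
    fix y \<phi> w
    assume all: "\<forall>\<alpha>\<in>A. \<forall>x\<in>?S. \<forall>\<beta>\<in>A. \<forall>y\<in>?S. ?P y (\<Phi> \<alpha> \<beta>) (\<beta> x)"
      and y: "y \<in> ?S" and \<phi>: "\<phi> \<in> A" and w: "w \<in> ?S"
    \<comment> \<open>Choosing the identity for \<beta> already reaches every pair of \<phi> and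
      \<open>w\<close>.\<close>
    have "\<Phi> \<phi> \<one>\<^bsub>?B\<^esub> = \<phi>" using AB'[OF \<phi>] by (simp add: \<Phi>_def)
    moreover have "\<one>\<^bsub>?B\<^esub> w = w" using w by (simp add: BijGroup_def)
    ultimately show "?P y \<phi> w"
      using all \<phi> w subgroup.one_closed[OF AB] y by metis
  next
    fix \<alpha> x \<beta> y
    assume all: "\<forall>y\<in>?S. \<forall>\<phi>\<in>A. \<forall>w\<in>?S. ?P y \<phi> w"
      and \<alpha>: "\<alpha> \<in> A" and x: "x \<in> ?S" and \<beta>: "\<beta> \<in> A" and y: "y \<in> ?S"
    show "?P y (\<Phi> \<alpha> \<beta>) (\<beta> x)"
      by (rule all[rule_format, OF y \<Phi>A[OF \<alpha> \<beta>] auto_closed[OF aut[OF \<beta>] x]])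
  qed
  finally show ?thesis .
qed

text \<open>Left multiplication by \<open>y\<close> permutes the loop, so \<open>w\<close> may be
  replaced by \<open>y \<otimes> z\<close>. The element \<open>c\<close> is later taken to be
  \<open>\<phi> y\<close>.\<close>

lemma translations_eq_iff:
  assumes c: "c \<in> carrier Q" and y: "y \<in> carrier Q"
  shows "(\<forall>w\<in>carrier Q. y \<otimes> ((inv y \<otimes> w) \<otimes> y) = c \<otimes> ((inv c \<otimes> w) \<otimes> y)) \<longleftrightarrow>
    (\<forall>z\<in>carrier Q. inv c \<otimes> (y \<otimes> (z \<otimes> y)) = (inv c \<otimes> (y \<otimes> z)) \<otimes> y)"
    (is "(\<forall>w\<in>_. ?P w) \<longleftrightarrow> (\<forall>z\<in>_. ?R z)")
proof -
  have PR: "?P (y \<otimes> z) \<longleftrightarrow> ?R z" if z: "z \<in> carrier Q" for z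
  proof -
    have "?P (y \<otimes> z) \<longleftrightarrow> y \<otimes> (z \<otimes> y) = c \<otimes> ((inv c \<otimes> (y \<otimes> z)) \<otimes> y)"
      using y z by (simp add: inv_mult_cancel)
    \<comment> \<open>Left multiplications by \<open>c\<close> and by \<open>inv c\<close> undo each
      other, so the outer \<open>c\<close> can be moved to the other side in both
      directions.\<close>
    also have "\<dots> \<longleftrightarrow> ?R z"
      using c y z inv_mult_cancel mult_inv_cancel by (metis m_inv_closed mult_closed)
    finally show ?thesis .
  qed
  show ?thesis
  proof (intro iffI ballI)
    fix z assume all: "\<forall>w\<in>carrier Q. ?P w" and z: "z \<in> carrier Q"
    from bspec[OF all mult_closed[OF y z]] show "?R z" by (rule PR[OF z, THEN iffD1])
  next
    fix w assume all: "\<forall>z\<in>carrier Q. ?R z" and w: "w \<in> carrier Q"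
    \<comment> \<open>This element is the solution \<open>z\<close> of
      \<open>y \<otimes> z = w\<close>.\<close>
    have z: "inv y \<otimes> w \<in> carrier Q" using y w by (simp add: mult_closed m_inv_closed)
    from bspec[OF all z] have "?P (y \<otimes> (inv y \<otimes> w))" by (rule PR[OF z, THEN iffD2])
    then show "?P w" using y w by (simp only: mult_inv_cancel)
  qed
qed

end

section \<open>Equivalence of the three conditions\<close>

theorem theorem2p6:
  fixes Q :: "('a, 'b) monoid_scheme" (structure)
    and A :: "('a \<Rightarrow> 'a) set"
  assumes "left_bol_loop Q"
    and "subgroup A (AutoGroup Q)"
  defines "S \<equiv> carrier Q"
    and "L \<equiv> left_translation Q"
    and "R \<equiv> right_translation Q"
  defines "cond_i \<equiv>
      same_structure (left_combined_holomorph Q A A) (holomorph (middle_bol Q) A)"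
    and "cond_ii \<equiv> (\<forall>y\<in>S. \<forall>\<phi>\<in>A.
      then_map S (then_map S (inv\<^bsub>BijGroup S\<^esub> (L y)) (R y)) (L y) =
      then_map S (then_map S (inv\<^bsub>BijGroup S\<^esub> (L (\<phi> y))) (R y)) (L (\<phi> y)))"
    and "cond_iii \<equiv> (\<forall>y\<in>S. \<forall>z\<in>S. \<forall>\<phi>\<in>A.
      \<phi> (inv y) \<otimes> (y \<otimes> (z \<otimes> y)) = (\<phi> (inv y) \<otimes> (y \<otimes> z)) \<otimes> y)"
  shows "(cond_i \<longleftrightarrow> cond_ii) \<and> (cond_ii \<longleftrightarrow> cond_iii)"
proof -
  interpret left_bol_loop Q by fact
  have aut: "\<phi> \<in> auto Q" if "\<phi> \<in> A" for \<phi>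
    using subgroup.subset[OF assms(2)] that by (auto simp: AutoGroup_def)
  \<comment> \<open>The composed maps in (ii) are extensional, so their equality amounts to
    agreement on the carrier.\<close>
  have restrict_eq: "restrict f S = restrict g S \<longleftrightarrow> (\<forall>w\<in>S. f w = g w)" for f g :: "'a \<Rightarrow> 'a"
    by (auto simp: restrict_def fun_eq_iff)
  have ii: "cond_ii \<longleftrightarrow> (\<forall>y\<in>S. \<forall>\<phi>\<in>A. \<forall>w\<in>S.
      y \<otimes> ((inv y \<otimes> w) \<otimes> y) = \<phi> y \<otimes> ((inv (\<phi> y) \<otimes> w) \<otimes> y))"
    unfolding cond_ii_def L_def R_def
    using then_map_translations auto_closed[OF aut] by (simp add: S_def restrict_eq[unfolded S_def])
  have "cond_i \<longleftrightarrow> cond_ii"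
    unfolding ii using same_structure_combined_iff[OF assms(2)] by (simp add: cond_i_def S_def)
  moreover have "cond_ii \<longleftrightarrow> cond_iii"
  proof -
    have "cond_ii \<longleftrightarrow> (\<forall>y\<in>S. \<forall>\<phi>\<in>A. \<forall>z\<in>S.
        inv (\<phi> y) \<otimes> (y \<otimes> (z \<otimes> y)) = (inv (\<phi> y) \<otimes> (y \<otimes> z)) \<otimes> y)"
      unfolding ii S_def
      by (rule ball_cong[OF refl], rule ball_cong[OF refl], rule translations_eq_iff)
        (simp_all add: auto_closed[OF aut])
    \<comment> \<open>The identity obtained involves \<open>inv (\<phi> y)\<close>, while (iii) is
      written with \<open>\<phi> (inv y)\<close>; these agree because \<phi> is an
      automorphism.\<close>
    then show ?thesis
      unfolding cond_iii_def S_def by (auto simp: auto_inv[OF aut])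
  qed
  ultimately show ?thesis by blast
qed

end
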